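(* Let $A$ be a connected Nakayama algebra. Then all cycles in the resolution quiver $R(A)$ are of the same size and of the same weight; that is, if $C$ and $C'$ are any two cycles in $R(A)$, then $C$ and $C'$ have the same number of vertices and $w(C)=w(C')$.
   Context: Algebras are Artin algebras; all modules are left modules of finite length. An algebra is a Nakayama algebra if all its indecomposable projective and indecomposable injective modules are uniserial. Let $A$ be a connected Nakayama algebra, and let $n=n(A)$ be the number of isomorphism classes of simple $A$-modules. Let $S_1,\dots,S_n$ be a complete set of pairwise non-isomorphic simple $A$-modules and let $P_i$ be the projective cover of $S_i$, ordered so that $\mathrm{rad}\,P_i$ is a factor module of $P_{i+1}$ for all $1\le i\le n$ (where $n+1$ is identified with $1$). Let $c_i$ be the length of $P_i$; the sequence $\mathbf{c}(A)=(c_1,\dots,c_n)$ is called an admissible sequence for $A$. Let $f_A:\{1,\dots,n\}\to\{1,\dots,n\}$ be the map such that $n$ divides $f_A(i)-(c_i+i)$ for all $i$. The resolution quiver $R(A)$ is the quiver with vertices $1,\dots,n$ and exactly one arrow $i\to f_A(i)$ for each vertex $i$. A cycle in $R(A)$ is an oriented cycle with pairwise distinct vertices $x_1,\dots,x_s$ ($s\ge 1$; loops are allowed), where $f_A(x_j)=x_{j+1}$ and $x_{s+1}=x_1$. The size of a cycle $C$ is its number of vertices, and its weight is $w(C)=\frac{\sum_{k}c_k}{n(A)}$, where $k$ runs over all vertices of $C$. *)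

theory Defs
  imports Complex_Main "HOL-Algebra.Algebra" "HOL-Library.Extended_Nat"
begin

section \<open>Artin algebras\<close>

definition artinian_cring :: "('k, 'l) ring_scheme \<Rightarrow> bool" where
  "artinian_cring k \<longleftrightarrow> cring k \<and>
     (\<forall>I :: nat \<Rightarrow> 'k set. (\<forall>i. ideal (I i) k) \<and> (\<forall>i. I (Suc i) \<subseteq> I i)
        \<longrightarrow> (\<exists>m. \<forall>i\<ge>m. I i = I m))"

text \<open>
  An Artin algebra: a not necessarily commutative algebra which is finitely generated as a
  module over a commutative artinian ring.  (The locale \<^locale>\<open>algebra\<close> of the library covers
  commutative algebras only.)
\<close>

definition artin_algebra :: "('k, 'l) ring_scheme \<Rightarrow> ('k, 'a, 'm) module_scheme \<Rightarrow> bool" where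
  "artin_algebra k A \<longleftrightarrow> artinian_cring k \<and> ring A \<and> Module.module k A \<and>
     (\<forall>r\<in>carrier k. \<forall>x\<in>carrier A. \<forall>y\<in>carrier A.
        (r \<odot>\<^bsub>A\<^esub> x) \<otimes>\<^bsub>A\<^esub> y = r \<odot>\<^bsub>A\<^esub> (x \<otimes>\<^bsub>A\<^esub> y) \<and>
        x \<otimes>\<^bsub>A\<^esub> (r \<odot>\<^bsub>A\<^esub> y) = r \<odot>\<^bsub>A\<^esub> (x \<otimes>\<^bsub>A\<^esub> y)) \<and>
     (\<exists>G. finite G \<and> G \<subseteq> carrier A \<and>
        (\<forall>U. submodule U k A \<and> G \<subseteq> U \<longrightarrow> U = carrier A))"

text \<open>
  Connected: nonzero and not a direct product of two nonzero algebras.  The factors of a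
  decomposition are isomorphic to two-sided ideals of the ring, so it is no restriction
  to take them with the same element type.
\<close>

definition connected_ring :: "('a, 'r) ring_scheme \<Rightarrow> bool" where
  "connected_ring A \<longleftrightarrow> carrier A \<noteq> {\<zero>\<^bsub>A\<^esub>} \<and>
     \<not> (\<exists>(B :: 'a ring) (C :: 'a ring). ring B \<and> ring C \<and> carrier B \<noteq> {\<zero>\<^bsub>B\<^esub>} \<and> carrier C \<noteq> {\<zero>\<^bsub>C\<^esub>} \<and>
          A \<simeq> RDirProd B C)"


section \<open>Left modules\<close>

text \<open>
  As in \<^locale>\<open>module\<close>, but over a ring that need not be commutative.  The multiplicative
  fields of the module record are irrelevant.
\<close>

locale lmodule = R?: ring R + M?: abelian_group M
  for R :: "('a, 'r) ring_scheme" (structure) and M :: "('a, 'b, 'm) module_scheme" (structure) +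
  assumes smult_closed:
      "\<lbrakk>a \<in> carrier R; x \<in> carrier M\<rbrakk> \<Longrightarrow> a \<odot>\<^bsub>M\<^esub> x \<in> carrier M"
    and smult_l_distr:
      "\<lbrakk>a \<in> carrier R; b \<in> carrier R; x \<in> carrier M\<rbrakk> \<Longrightarrow>
       (a \<oplus> b) \<odot>\<^bsub>M\<^esub> x = a \<odot>\<^bsub>M\<^esub> x \<oplus>\<^bsub>M\<^esub> b \<odot>\<^bsub>M\<^esub> x"
    and smult_r_distr:
      "\<lbrakk>a \<in> carrier R; x \<in> carrier M; y \<in> carrier M\<rbrakk> \<Longrightarrow>
       a \<odot>\<^bsub>M\<^esub> (x \<oplus>\<^bsub>M\<^esub> y) = a \<odot>\<^bsub>M\<^esub> x \<oplus>\<^bsub>M\<^esub> a \<odot>\<^bsub>M\<^esub> y"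
    and smult_assoc1:
      "\<lbrakk>a \<in> carrier R; b \<in> carrier R; x \<in> carrier M\<rbrakk> \<Longrightarrow>
       (a \<otimes> b) \<odot>\<^bsub>M\<^esub> x = a \<odot>\<^bsub>M\<^esub> (b \<odot>\<^bsub>M\<^esub> x)"
    and smult_one:
      "x \<in> carrier M \<Longrightarrow> \<one> \<odot>\<^bsub>M\<^esub> x = x"

definition lmodule_hom ::
  "('a, 'r) ring_scheme \<Rightarrow> ('a, 'b, 'm) module_scheme \<Rightarrow> ('a, 'c, 'n) module_scheme
     \<Rightarrow> ('b \<Rightarrow> 'c) set" where
  "lmodule_hom R M N =
     {h \<in> carrier M \<rightarrow> carrier N.
        (\<forall>x\<in>carrier M. \<forall>y\<in>carrier M. h (x \<oplus>\<^bsub>M\<^esub> y) = h x \<oplus>\<^bsub>N\<^esub> h y) \<and>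
        (\<forall>a\<in>carrier R. \<forall>x\<in>carrier M. h (a \<odot>\<^bsub>M\<^esub> x) = a \<odot>\<^bsub>N\<^esub> h x)}"

definition lmodule_isomorphic ::
  "('a, 'r) ring_scheme \<Rightarrow> ('a, 'b, 'm) module_scheme \<Rightarrow> ('a, 'c, 'n) module_scheme \<Rightarrow> bool" where
  "lmodule_isomorphic R M N \<longleftrightarrow>
     (\<exists>h\<in>lmodule_hom R M N. bij_betw h (carrier M) (carrier N))"

text \<open>Being a factor module is meant up to isomorphism.\<close>

definition factor_module ::
  "('a, 'r) ring_scheme \<Rightarrow> ('a, 'c, 'n) module_scheme \<Rightarrow> ('a, 'b, 'm) module_scheme \<Rightarrow> bool" where
  "factor_module R N M \<longleftrightarrow> (\<exists>h\<in>lmodule_hom R M N. h ` carrier M = carrier N)"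

text \<open>
  By the Jordan-Hoelder theorem this agrees with the length of a composition series, if there
  is one, and it is infinite otherwise.
\<close>

definition lmodule_length ::
  "('a, 'r) ring_scheme \<Rightarrow> ('a, 'b, 'm) module_scheme \<Rightarrow> enat" where
  "lmodule_length R M =
     Sup {enat l |l. \<exists>U :: nat \<Rightarrow> 'b set. (\<forall>i\<le>l. submodule (U i) R M) \<and> (\<forall>i<l. U i \<subset> U (Suc i))}"

definition finite_length_lmodule ::
  "('a, 'r) ring_scheme \<Rightarrow> ('a, 'b, 'm) module_scheme \<Rightarrow> bool" where
  "finite_length_lmodule R M \<longleftrightarrow> lmodule R M \<and> lmodule_length R M \<noteq> \<infinity>"

definition simple_lmodule ::
  "('a, 'r) ring_scheme \<Rightarrow> ('a, 'b, 'm) module_scheme \<Rightarrow> bool" where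
  "simple_lmodule R M \<longleftrightarrow> lmodule R M \<and> carrier M \<noteq> {\<zero>\<^bsub>M\<^esub>} \<and>
     (\<forall>U. submodule U R M \<longrightarrow> U = {\<zero>\<^bsub>M\<^esub>} \<or> U = carrier M)"

definition uniserial_lmodule ::
  "('a, 'r) ring_scheme \<Rightarrow> ('a, 'b, 'm) module_scheme \<Rightarrow> bool" where
  "uniserial_lmodule R M \<longleftrightarrow> lmodule R M \<and>
     (\<forall>U V. submodule U R M \<and> submodule V R M \<longrightarrow> U \<subseteq> V \<or> V \<subseteq> U)"

definition indecomposable_lmodule ::
  "('a, 'r) ring_scheme \<Rightarrow> ('a, 'b, 'm) module_scheme \<Rightarrow> bool" where
  "indecomposable_lmodule R M \<longleftrightarrow> lmodule R M \<and> carrier M \<noteq> {\<zero>\<^bsub>M\<^esub>} \<and>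
     (\<forall>U V. submodule U R M \<and> submodule V R M \<and> U <+>\<^bsub>M\<^esub> V = carrier M \<and> U \<inter> V = {\<zero>\<^bsub>M\<^esub>}
        \<longrightarrow> U = {\<zero>\<^bsub>M\<^esub>} \<or> V = {\<zero>\<^bsub>M\<^esub>})"

definition maximal_submodule ::
  "'b set \<Rightarrow> ('a, 'r) ring_scheme \<Rightarrow> ('a, 'b, 'm) module_scheme \<Rightarrow> bool" where
  "maximal_submodule U R M \<longleftrightarrow> submodule U R M \<and> U \<noteq> carrier M \<and>
     (\<forall>V. submodule V R M \<and> U \<subseteq> V \<longrightarrow> V = U \<or> V = carrier M)"

definition lmodule_rad ::
  "('a, 'r) ring_scheme \<Rightarrow> ('a, 'b, 'm) module_scheme \<Rightarrow> ('a, 'b, 'm) module_scheme" where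
  "lmodule_rad R M = M\<lparr>carrier := carrier M \<inter> \<Inter>{U. maximal_submodule U R M}\<rparr>"

text \<open>
  Projectivity and injectivity are meant in the category of modules of finite length.
  The test modules are quantified over one fixed carrier type: a module of finite length
  over a ring with elements of type \<open>'a\<close> is a quotient of a free module of finite rank, so it
  is isomorphic to one whose elements are cosets, of type \<^typ>\<open>(nat \<Rightarrow> 'a) set\<close>.  Hence every
  isomorphism class of modules of finite length is represented over this type.
\<close>

type_synonym 'a std_module = "('a, (nat \<Rightarrow> 'a) set) module"

definition projective_lmodule ::
  "('a, 'r) ring_scheme \<Rightarrow> ('a, 'b, 'm) module_scheme \<Rightarrow> bool" where
  "projective_lmodule R P \<longleftrightarrow> finite_length_lmodule R P \<and>
     (\<forall>(M :: 'a std_module) (N :: 'a std_module).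
        finite_length_lmodule R M \<and> finite_length_lmodule R N \<longrightarrow>
        (\<forall>g\<in>lmodule_hom R M N. g ` carrier M = carrier N \<longrightarrow>
          (\<forall>f\<in>lmodule_hom R P N. \<exists>h\<in>lmodule_hom R P M. \<forall>x\<in>carrier P. g (h x) = f x)))"

definition injective_lmodule ::
  "('a, 'r) ring_scheme \<Rightarrow> ('a, 'b, 'm) module_scheme \<Rightarrow> bool" where
  "injective_lmodule R Q \<longleftrightarrow> finite_length_lmodule R Q \<and>
     (\<forall>(M :: 'a std_module) (N :: 'a std_module).
        finite_length_lmodule R M \<and> finite_length_lmodule R N \<longrightarrow>
        (\<forall>g\<in>lmodule_hom R M N. inj_on g (carrier M) \<longrightarrow>
          (\<forall>f\<in>lmodule_hom R M Q. \<exists>h\<in>lmodule_hom R N Q. \<forall>x\<in>carrier M. h (g x) = f x)))"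

definition projective_cover ::
  "('a, 'r) ring_scheme \<Rightarrow> ('a, 'b, 'm) module_scheme \<Rightarrow> ('a, 'c, 'n) module_scheme \<Rightarrow> bool" where
  "projective_cover R P M \<longleftrightarrow> projective_lmodule R P \<and>
     (\<exists>p\<in>lmodule_hom R P M. p ` carrier P = carrier M \<and>
        (\<forall>U. submodule U R P \<and> U <+>\<^bsub>P\<^esub> a_kernel P M p = carrier P \<longrightarrow> U = carrier P))"


section \<open>Nakayama algebras\<close>

definition nakayama_ring :: "('a, 'r) ring_scheme \<Rightarrow> bool" where
  "nakayama_ring A \<longleftrightarrow>
     (\<forall>M :: 'a std_module. indecomposable_lmodule A M \<and>
        (projective_lmodule A M \<or> injective_lmodule A M) \<longrightarrow> uniserial_lmodule A M)"

definition num_simples :: "('a, 'r) ring_scheme \<Rightarrow> nat" where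
  "num_simples A =
     card ({T :: 'a std_module. simple_lmodule A T} //
           {(T, T'). simple_lmodule A T \<and> simple_lmodule A T' \<and> lmodule_isomorphic A T T'})"

definition cyclic_succ :: "nat \<Rightarrow> nat \<Rightarrow> nat" where
  "cyclic_succ n i = (if i = n then 1 else i + 1)"

text \<open>
  The simple modules \<open>S i\<close> and their projective covers \<open>P i\<close>, for \<open>1 \<le> i \<le> n\<close>, are ordered
  so that \<open>c i\<close>, the length of \<open>P i\<close>, is an admissible sequence for A.
\<close>

definition admissible_sequence ::
  "('a, 'r) ring_scheme \<Rightarrow> nat \<Rightarrow> (nat \<Rightarrow> ('a, 's) module) \<Rightarrow> (nat \<Rightarrow> ('a, 'p) module)
     \<Rightarrow> (nat \<Rightarrow> nat) \<Rightarrow> bool" where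
  "admissible_sequence A n S P c \<longleftrightarrow> n = num_simples A \<and>
     (\<forall>i\<in>{1..n}. simple_lmodule A (S i)) \<and>
     (\<forall>i\<in>{1..n}. \<forall>j\<in>{1..n}. i \<noteq> j \<longrightarrow> \<not> lmodule_isomorphic A (S i) (S j)) \<and>
     (\<forall>T :: 'a std_module. simple_lmodule A T \<longrightarrow> (\<exists>i\<in>{1..n}. lmodule_isomorphic A T (S i))) \<and>
     (\<forall>i\<in>{1..n}. projective_cover A (P i) (S i)) \<and>
     (\<forall>i\<in>{1..n}. factor_module A (lmodule_rad A (P i)) (P (cyclic_succ n i))) \<and>
     (\<forall>i\<in>{1..n}. lmodule_length A (P i) = enat (c i))"


section \<open>The resolution quiver\<close>

definition resolution_map :: "nat \<Rightarrow> (nat \<Rightarrow> nat) \<Rightarrow> nat \<Rightarrow> nat" where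
  "resolution_map n c i = (THE j. j \<in> {1..n} \<and> int n dvd int j - (int (c i) + int i))"

text \<open>
  The resolution quiver has vertices \<open>1, \<dots>, n\<close> and exactly one arrow from each vertex \<open>i\<close>, ending
  at \<open>resolution_map n c i\<close>.  A cycle is given by the list of its pairwise distinct vertices.
\<close>

definition resolution_cycle :: "nat \<Rightarrow> (nat \<Rightarrow> nat) \<Rightarrow> nat list \<Rightarrow> bool" where
  "resolution_cycle n c xs \<longleftrightarrow> xs \<noteq> [] \<and> distinct xs \<and> set xs \<subseteq> {1..n} \<and>
     (\<forall>j<length xs. resolution_map n c (xs ! j) = xs ! (Suc j mod length xs))"

definition cycle_weight :: "nat \<Rightarrow> (nat \<Rightarrow> nat) \<Rightarrow> nat list \<Rightarrow> rat" where
  "cycle_weight n c xs = of_nat (\<Sum>k\<in>set xs. c k) / of_nat n"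

end

theory Submission
  imports Defs
begin

text \<open>
  Every proper submodule of \<open>P\<^sub>i\<close> lies in its radical, so a strict chain in \<open>P\<^sub>i\<close> loses at most its
  top term when it is pulled back along \<open>P\<^sub>i\<^sub>+\<^sub>1 \<rightarrow> rad P\<^sub>i\<close>; hence \<open>c\<^sub>i \<le> c\<^sub>i\<^sub>+\<^sub>1 + 1\<close>.  This inequality
  says that the lift \<open>x \<mapsto> x + c\<^sub>x\<close> of the resolution map to the integers, with \<open>c\<close> extended
  periodically, is monotone; it commutes with the translation by \<open>n\<close>.  The resolution map is thus
  like a circle map of degree one.  A cycle of size \<open>s\<close> and weight \<open>m\<close> corresponds to a point that
  is moved by \<open>m n\<close> in \<open>s\<close> steps, so \<open>m / s\<close> is the rotation number, which does not depend on the
  cycle, and monotonicity forces \<open>s\<close> and \<open>m\<close> to be coprime.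
\<close>

section \<open>Monotone maps of degree one on the integers\<close>

locale monotone_degree_one =
  fixes F :: "int \<Rightarrow> int" and n :: nat
  assumes mono: "mono F"
    and n_pos: "n > 0"
    and translate: "\<And>x. F (x + int n) = F x + int n"
begin

lemma translate_mult: "F (x + j * int n) = F x + j * int n"
proof (induction j rule: int_induct[of _ 0])
  case base
  show ?case by simp
next
  case (step1 i)
  then show ?case
    using translate[of "x + i * int n"] by (simp add: algebra_simps)
next
  case (step2 i)
  then show ?case
    using translate[of "x + (i - 1) * int n"] by (simp add: algebra_simps)
qed

lemma funpow_translate: "(F ^^ k) (x + j * int n) = (F ^^ k) x + j * int n"
  by (induction k) (simp_all add: translate_mult)

text \<open>\<open>F ^^ s\<close> commutes with translations by multiples of \<open>n\<close>, so
  each further block of \<open>s\<close> steps starts at a translate of \<open>x\<close> and adds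
  \<open>m * n\<close> again.\<close>

lemma funpow_mult_moves:
  assumes "(F ^^ s) x = x + m * int n"
  shows "(F ^^ (s * t)) x = x + int t * m * int n"
proof (induction t)
  case 0
  show ?case by simp
next
  case (Suc t)
  have "(F ^^ (s * Suc t)) x = (F ^^ s) ((F ^^ (s * t)) x)"
    by (simp add: funpow_add)
  also have "\<dots> = (F ^^ s) (x + (int t * m) * int n)"
    by (simp only: Suc.IH)
  also have "\<dots> = x + int (Suc t) * m * int n"
    by (simp only: funpow_translate assms) (simp add: algebra_simps)
  finally show ?case .
qed

text \<open>Translate \<open>y\<close> into the window from \<open>x\<close> to
  \<open>x + n\<close>. After \<open>s * t\<close> steps the two orbits are still in order, so
  \<open>t * m * n < (s * p + 1) * n\<close>, and integrality gives the bound. Used in both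
  directions with positive \<open>s\<close> and \<open>t\<close>, it shows that \<open>m / s\<close>
  and \<open>p / t\<close> coincide.\<close>

lemma rotation_le:
  assumes x: "(F ^^ s) x = x + m * int n" and y: "(F ^^ t) y = y + p * int n"
  shows "int t * m \<le> int s * p"
proof -
  \<comment> \<open>Removing \<open>(y - x) div n\<close> periods from \<open>y\<close> leaves it at
    distance \<open>(y - x) mod n\<close> above \<open>x\<close>.\<close>
  let ?j = "- ((y - x) div int n)"
  let ?y = "y + ?j * int n"
  have y': "?y = x + (y - x) mod int n"
    by (simp add: minus_div_mult_eq_mod[symmetric])
  have "x \<le> ?y" and less: "?y < x + int n"
    using n_pos by (simp_all only: y') simp_all
  then have "(F ^^ (s * t)) x \<le> (F ^^ (s * t)) ?y"
    using mono by (intro funpow_mono)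
  also have "\<dots> = ?y + int s * p * int n"
    using funpow_mult_moves[OF y, of s] by (simp only: funpow_translate mult.commute[of s t])
  finally have "x + int t * m * int n < (int s * p + 1) * int n + x"
    using less unfolding funpow_mult_moves[OF x] by (simp add: algebra_simps)
  then have "(int t * m) * int n < (int s * p + 1) * int n"
    by simp
  then show ?thesis
    using n_pos by (simp only: mult_less_cancel_right) simp
qed

text \<open>\<open>F ^^ s\<close> followed by the translation by \<open>- m * n\<close> is a
  monotone map \<open>G\<close> with \<open>(G ^^ g) x = x\<close>. A monotone map of a linear order
  has no periodic points besides its fixed points.\<close>

lemma periodic_moves_root:
  assumes "(F ^^ (s * g)) x = x + (m * int g) * int n" and "g > 0"
  shows "(F ^^ s) x = x + m * int n"
proof -
  define G where "G y = (F ^^ s) y - m * int n" for y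
  have "mono G"
    unfolding G_def using mono_pow[OF mono, of s] by (auto simp: mono_def)
  have G_pow: "(G ^^ k) y = (F ^^ (s * k)) y - (m * int k) * int n" for k y
  proof (induction k)
    case 0
    show ?case by simp
  next
    case (Suc k)
    have "(G ^^ Suc k) y = (F ^^ s) ((F ^^ (s * k)) y + (- m * int k) * int n) - m * int n"
      by (simp add: Suc.IH G_def)
    also have "\<dots> = (F ^^ (s * Suc k)) y - (m * int (Suc k)) * int n"
      by (simp only: funpow_translate) (simp add: funpow_add algebra_simps)
    finally show ?case .
  qed
  \<comment> \<open>Since \<open>g > 0\<close>, writing \<open>g\<close> as
    \<open>Suc (g - 1)\<close> exposes one outermost application of \<open>G\<close>.\<close>
  have fix_pt: "(G ^^ Suc (g - 1)) x = x"
    using assms by (simp add: G_pow del: funpow.simps)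
  have "G x = x"
  proof (rule antisym)
    have up: "y \<le> G y \<Longrightarrow> y \<le> (G ^^ k) y" and down: "G y \<le> y \<Longrightarrow> (G ^^ k) y \<le> y" for k y
      by (induction k) (use \<open>mono G\<close> in \<open>auto dest: monoD order_trans\<close>)
    \<comment> \<open>If \<open>x\<close> moves up, its orbit stays above it, so
      \<open>x \<le> (G ^^ (g - 1)) x\<close>. One more application of \<open>G\<close> returns the
      right side to \<open>x\<close>.\<close>
    have le: "G x \<le> x" if "x \<le> G x"
    proof -
      have "G x \<le> G ((G ^^ (g - 1)) x)"
        using up[OF that] \<open>mono G\<close> by (rule monoD[rotated])
      then show ?thesis using fix_pt by simp
    qed
    have ge: "x \<le> G x" if "G x \<le> x"
    proof -
      have "G ((G ^^ (g - 1)) x) \<le> G x"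
        using down[OF that] \<open>mono G\<close> by (rule monoD[rotated])
      then show ?thesis using fix_pt by simp
    qed
    show "G x \<le> x" using le linear by blast
    show "x \<le> G x" using ge linear by blast
  qed
  then show ?thesis by (simp add: G_def)
qed

text \<open>A common divisor \<open>g > 1\<close> would, by \<open>periodic_moves_root\<close>, give
  a return modulo \<open>n\<close> after only \<open>s / g\<close> steps, against
  minimality.\<close>

lemma minimal_period_coprime:
  assumes x: "(F ^^ s) x = x + int m * int n" and "s > 0"
    and min: "\<And>k. 0 < k \<Longrightarrow> k < s \<Longrightarrow> \<not> int n dvd (F ^^ k) x - x"
  shows "coprime s m"
proof (rule ccontr)
  assume "\<not> coprime s m"
  define g where "g = gcd s m"
  have "g > 0" "g \<noteq> 1"
    using \<open>s > 0\<close> \<open>\<not> coprime s m\<close> by (auto simp: g_def coprime_iff_gcd_eq_1)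
  obtain a b where ab: "s = a * g" "m = b * g"
    unfolding g_def by (metis dvd_div_mult_self gcd_dvd1 gcd_dvd2)
  have "(F ^^ a) x = x + int b * int n"
    using x ab \<open>g > 0\<close> by (intro periodic_moves_root[of a g]) simp_all
  moreover have "0 < a" "a < s"
    using ab \<open>s > 0\<close> \<open>g > 0\<close> \<open>g \<noteq> 1\<close> by (auto intro: Nat.gr0I)
  ultimately show False
    using min[of a] by simp
qed

text \<open>The rotation numbers \<open>m / s\<close> and \<open>p / t\<close> coincide, and both
  fractions are in lowest terms.\<close>

lemma minimal_periods_agree:
  assumes x: "(F ^^ s) x = x + int m * int n" "s > 0"
      "\<And>k. 0 < k \<Longrightarrow> k < s \<Longrightarrow> \<not> int n dvd (F ^^ k) x - x"
    and y: "(F ^^ t) y = y + int p * int n" "t > 0"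
      "\<And>k. 0 < k \<Longrightarrow> k < t \<Longrightarrow> \<not> int n dvd (F ^^ k) y - y"
  shows "s = t \<and> m = p"
proof -
  have "int t * int m = int s * int p"
    using rotation_le[OF x(1) y(1)] rotation_le[OF y(1) x(1)] by simp
  then have "s * p = t * m"
    by (simp flip: of_nat_mult)
  moreover have "coprime s m" "coprime t p"
    by (rule minimal_period_coprime[OF x] minimal_period_coprime[OF y]; assumption)+
  ultimately show ?thesis
    by (simp add: coprime_crossproduct_nat)
qed

end


section \<open>Cycles of the resolution quiver\<close>

text \<open>Residues are represented in \<open>{1..n}\<close>, where the vertices live; hence the
  shift by one before and after \<open>mod\<close>.\<close>

definition cyclic_rep :: "nat \<Rightarrow> int \<Rightarrow> nat" where
  "cyclic_rep n x = nat ((x - 1) mod int n + 1)"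

definition resolution_lift :: "nat \<Rightarrow> (nat \<Rightarrow> nat) \<Rightarrow> int \<Rightarrow> int" where
  "resolution_lift n c x = x + int (c (cyclic_rep n x))"

lemma cyclic_rep_in:
  assumes "n > 0" shows "cyclic_rep n x \<in> {1..n}"
  using assms pos_mod_bound[of "int n" "x - 1"] pos_mod_sign[of "int n" "x - 1"]
  by (auto simp: cyclic_rep_def simp del: pos_mod_bound pos_mod_sign)

lemma cyclic_rep_dvd:
  assumes "n > 0" shows "int n dvd x - int (cyclic_rep n x)"
  using assms by (auto simp: cyclic_rep_def algebra_simps mod_eq_dvd_iff[symmetric] mod_simps)

lemma cyclic_rep_unique:
  assumes "i \<in> {1..n}" "j \<in> {1..n}" "int n dvd int i - int j"
  shows "i = j"
proof -
  have "\<bar>int i - int j\<bar> < int n"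
    using assms(1,2) by auto
  then show ?thesis
    using assms(3) zdvd_imp_le[of "int n" "\<bar>int i - int j\<bar>"] by fastforce
qed

lemma cyclic_rep_eqI:
  assumes "j \<in> {1..n}" "int n dvd x - int j"
  shows "cyclic_rep n x = j"
proof -
  have n: "n > 0" using assms(1) by simp
  have "int n dvd (x - int j) - (x - int (cyclic_rep n x))"
    using assms(2) cyclic_rep_dvd[OF n] by (rule dvd_diff)
  then show ?thesis
    using cyclic_rep_unique[OF cyclic_rep_in[OF n] assms(1)] by simp
qed

lemma cyclic_rep_Suc:
  assumes "n > 0"
  shows "cyclic_rep n (x + 1) = cyclic_succ n (cyclic_rep n x)"
proof (rule cyclic_rep_eqI)
  show "cyclic_succ n (cyclic_rep n x) \<in> {1..n}"
    using cyclic_rep_in[OF assms, of x] by (auto simp: cyclic_succ_def)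
  show "int n dvd x + 1 - int (cyclic_succ n (cyclic_rep n x))"
    using cyclic_rep_dvd[OF assms, of x]
    by (auto simp: cyclic_succ_def algebra_simps dvd_diff_left_iff)
qed

text \<open>Existence and uniqueness of a representative in \<open>{1..n}\<close> resolve the
  definite description.\<close>

lemma resolution_map_eq:
  assumes "n > 0"
  shows "resolution_map n c i = cyclic_rep n (int (c i) + int i)"
  unfolding resolution_map_def
proof (rule the_equality)
  let ?z = "int (c i) + int i"
  show "cyclic_rep n ?z \<in> {1..n} \<and> int n dvd int (cyclic_rep n ?z) - ?z"
    using cyclic_rep_in[OF assms] cyclic_rep_dvd[OF assms, of ?z]
    by (simp add: dvd_diff_commute)
  show "j = cyclic_rep n ?z" if "j \<in> {1..n} \<and> int n dvd int j - ?z" for j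
    using that by (intro cyclic_rep_eqI[symmetric]) (simp_all add: dvd_diff_commute)
qed

text \<open>Passing from \<open>x\<close> to \<open>x + 1\<close> changes the lift by
  \<open>1 + c (i + 1) - c i\<close>, with cyclic indices, which the hypothesis makes nonnegative.
  Longer steps are composed of unit steps.\<close>

lemma monotone_degree_one_resolution_lift:
  assumes "n > 0" and "\<And>i. i \<in> {1..n} \<Longrightarrow> c i \<le> c (cyclic_succ n i) + 1"
  shows "monotone_degree_one (resolution_lift n c) n"
proof
  have "resolution_lift n c x \<le> resolution_lift n c (x + int d)" for x d
  proof (induction d)
    case 0
    show ?case by simp
  next
    case (Suc d)
    have "resolution_lift n c y \<le> resolution_lift n c (y + 1)" for y
      using assms(2)[OF cyclic_rep_in[OF assms(1), of y]]
      by (simp add: resolution_lift_def cyclic_rep_Suc[OF assms(1)])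
    from Suc this[of "x + int d"] show ?case
      by (simp add: add.commute add.left_commute)
  qed
  then show "mono (resolution_lift n c)"
    by (intro monoI) (metis zle_iff_zadd)
  show "0 < n" by fact
  show "resolution_lift n c (x + int n) = resolution_lift n c x + int n" for x
    by (simp add: resolution_lift_def cyclic_rep_def add.commute diff_add_eq[symmetric])
qed

text \<open>By induction the current point reduces modulo \<open>n\<close> to the current vertex
  \<open>v\<close>, so the lift adds exactly \<open>c v\<close> and lands over the next vertex. The
  index is reduced because the walk goes round the cycle.\<close>

lemma resolution_lift_orbit:
  assumes "n > 0" and "resolution_cycle n c xs"
  shows "int n dvd (resolution_lift n c ^^ k) (int (xs ! 0)) - int (xs ! (k mod length xs))"
proof (induction k)
  case 0
  show ?case using assms(2) by (simp add: resolution_cycle_def)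
next
  case (Suc k)
  let ?y = "(resolution_lift n c ^^ k) (int (xs ! 0))"
  let ?v = "xs ! (k mod length xs)"
  have k: "k mod length xs < length xs"
    using assms(2) by (simp add: resolution_cycle_def)
  then have "?v \<in> {1..n}"
    using assms(2) nth_mem[OF k] unfolding resolution_cycle_def by blast
  then have rep: "cyclic_rep n ?y = ?v"
    using Suc by (rule cyclic_rep_eqI)
  have "xs ! (Suc k mod length xs) = resolution_map n c ?v"
    using assms(2) k by (simp add: resolution_cycle_def mod_Suc_eq)
  then have step: "int n dvd (int (c ?v) + int ?v) - int (xs ! (Suc k mod length xs))"
    using cyclic_rep_dvd[OF assms(1)] by (simp add: resolution_map_eq[OF assms(1)])
  have "resolution_lift n c ?y = ?y + int (c ?v)"
    by (simp add: resolution_lift_def rep)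
  then show ?case
    using dvd_add[OF Suc step] by (simp add: algebra_simps)
qed

text \<open>One trip round the cycle adds \<open>c\<close> of every vertex once and ends over the
  starting vertex, so the total is a multiple \<open>m * n\<close>, with \<open>m\<close> the
  weight. An earlier return modulo \<open>n\<close> would make two listed vertices equal.\<close>

lemma resolution_cycle_moves:
  assumes "n > 0" and "resolution_cycle n c xs"
  obtains m where "(\<Sum>k\<in>set xs. c k) = m * n"
    and "(resolution_lift n c ^^ length xs) (int (xs ! 0)) = int (xs ! 0) + int m * int n"
    and "\<And>k. 0 < k \<Longrightarrow> k < length xs \<Longrightarrow>
      \<not> int n dvd (resolution_lift n c ^^ k) (int (xs ! 0)) - int (xs ! 0)"
proof -
  let ?F = "resolution_lift n c"
  let ?x = "int (xs ! 0)"
  have xs: "xs \<noteq> []" "distinct xs" "set xs \<subseteq> {1..n}"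
    using assms(2) by (auto simp: resolution_cycle_def)
  note orbit = resolution_lift_orbit[OF assms]
  have in_range: "xs ! j \<in> {1..n}" if "j < length xs" for j
    using xs(3) nth_mem[OF that] by blast
  have "(?F ^^ k) ?x = ?x + (\<Sum>j<k. int (c (xs ! j)))" if "k \<le> length xs" for k
    using that
  proof (induction k)
    case (Suc k)
    then have "cyclic_rep n ((?F ^^ k) ?x) = xs ! k"
      using orbit[of k] in_range by (intro cyclic_rep_eqI) simp_all
    then have "?F ((?F ^^ k) ?x) = (?F ^^ k) ?x + int (c (xs ! k))"
      by (simp add: resolution_lift_def)
    with Suc show ?case
      by simp
  qed simp
  moreover have "(\<Sum>k\<in>set xs. c k) = (\<Sum>j<length xs. c (xs ! j))"
    using xs(2) by (intro sum.reindex_bij_betw[symmetric] bij_betw_nth) simp_all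
  ultimately have total: "(?F ^^ length xs) ?x = ?x + int (\<Sum>k\<in>set xs. c k)"
    by simp
  \<comment> \<open>At \<open>k = length xs\<close> the index in \<open>orbit\<close> wraps round to
    \<open>0\<close>.\<close>
  then have "n dvd (\<Sum>k\<in>set xs. c k)"
    using orbit[of "length xs"] by (simp flip: of_nat_sum)
  then obtain m where m: "(\<Sum>k\<in>set xs. c k) = m * n"
    by (metis dvd_def mult.commute)
  have "\<not> int n dvd (?F ^^ k) ?x - ?x" if k: "0 < k" "k < length xs" for k
  proof
    assume "int n dvd (?F ^^ k) ?x - ?x"
    from dvd_diff[OF this orbit[of k]] have "int n dvd int (xs ! k) - ?x"
      using k by simp
    then have "xs ! k = xs ! 0"
      using k xs(1) by (intro cyclic_rep_unique[of _ n] in_range) simp_all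
    then show False
      using xs(1,2) k by (simp add: nth_eq_iff_index_eq)
  qed
  with m total show thesis
    by (intro that[of m]) simp_all
qed

lemma resolution_cycles_agree:
  assumes "n > 0" and "\<And>i. i \<in> {1..n} \<Longrightarrow> c i \<le> c (cyclic_succ n i) + 1"
    and C: "resolution_cycle n c C" and C': "resolution_cycle n c C'"
  shows "length C = length C' \<and> cycle_weight n c C = cycle_weight n c C'"
proof -
  interpret monotone_degree_one "resolution_lift n c" n
    using assms(1,2) by (rule monotone_degree_one_resolution_lift)
  obtain m where m: "(\<Sum>k\<in>set C. c k) = m * n"
      "(resolution_lift n c ^^ length C) (int (C ! 0)) = int (C ! 0) + int m * int n"
      "\<And>k. 0 < k \<Longrightarrow> k < length C \<Longrightarrow>
        \<not> int n dvd (resolution_lift n c ^^ k) (int (C ! 0)) - int (C ! 0)"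
    using resolution_cycle_moves[OF assms(1) C] by blast
  obtain m' where m': "(\<Sum>k\<in>set C'. c k) = m' * n"
      "(resolution_lift n c ^^ length C') (int (C' ! 0)) = int (C' ! 0) + int m' * int n"
      "\<And>k. 0 < k \<Longrightarrow> k < length C' \<Longrightarrow>
        \<not> int n dvd (resolution_lift n c ^^ k) (int (C' ! 0)) - int (C' ! 0)"
    using resolution_cycle_moves[OF assms(1) C'] by blast
  have "length C > 0" "length C' > 0"
    using C C' by (auto simp: resolution_cycle_def)
  then have "length C = length C' \<and> m = m'"
    using minimal_periods_agree[OF m(2) _ m(3) m'(2) _ m'(3)] by blast
  then show ?thesis
    by (simp add: cycle_weight_def m(1) m'(1) del: of_nat_sum)
qed


section \<open>Submodules and length\<close>

context lmodule
begin

lemma smult_l_null: "x \<in> carrier M \<Longrightarrow> \<zero> \<odot>\<^bsub>M\<^esub> x = \<zero>\<^bsub>M\<^esub>"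
  by (metis M.add.r_cancel_one' R.l_zero R.zero_closed smult_closed smult_l_distr)

lemma smult_r_null: "a \<in> carrier R \<Longrightarrow> a \<odot>\<^bsub>M\<^esub> \<zero>\<^bsub>M\<^esub> = \<zero>\<^bsub>M\<^esub>"
  by (metis M.add.r_cancel_one' M.l_zero M.zero_closed smult_closed smult_r_distr)

lemma smult_minus_one:
  assumes "x \<in> carrier M" shows "(\<ominus> \<one>) \<odot>\<^bsub>M\<^esub> x = \<ominus>\<^bsub>M\<^esub> x"
proof (rule M.minus_equality[symmetric])
  have "(\<ominus> \<one>) \<odot>\<^bsub>M\<^esub> x \<oplus>\<^bsub>M\<^esub> x = (\<ominus> \<one> \<oplus> \<one>) \<odot>\<^bsub>M\<^esub> x"
    using assms by (simp add: smult_l_distr smult_one)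
  then show "(\<ominus> \<one>) \<odot>\<^bsub>M\<^esub> x \<oplus>\<^bsub>M\<^esub> x = \<zero>\<^bsub>M\<^esub>"
    using assms by (simp add: R.l_neg smult_l_null)
qed (use assms smult_closed in auto)

text \<open>Closure under negatives comes from scalar multiplication by
  \<open>\<ominus> \<one>\<close>.\<close>

lemma submoduleI:
  assumes "H \<subseteq> carrier M" "\<zero>\<^bsub>M\<^esub> \<in> H"
    and "\<And>x y. x \<in> H \<Longrightarrow> y \<in> H \<Longrightarrow> x \<oplus>\<^bsub>M\<^esub> y \<in> H"
    and smult: "\<And>a x. a \<in> carrier R \<Longrightarrow> x \<in> H \<Longrightarrow> a \<odot>\<^bsub>M\<^esub> x \<in> H"
  shows "submodule H R M"
proof (intro submodule.intro subgroup.intro submodule_axioms.intro)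
  show "inv\<^bsub>add_monoid M\<^esub> x \<in> H" if "x \<in> H" for x
    using smult[OF _ that, of "\<ominus> \<one>"] smult_minus_one[of x] assms(1) that
    by (auto simp: a_inv_def)
qed (use assms in auto)

lemma submodule_subset: "submodule U R M \<Longrightarrow> U \<subseteq> carrier M"
  using subgroup.subset[OF submodule.axioms(1)] by force

lemma submodule_zero: "submodule U R M \<Longrightarrow> \<zero>\<^bsub>M\<^esub> \<in> U"
  using subgroup.one_closed[OF submodule.axioms(1)] by force

lemma submodule_add: "submodule U R M \<Longrightarrow> x \<in> U \<Longrightarrow> y \<in> U \<Longrightarrow> x \<oplus>\<^bsub>M\<^esub> y \<in> U"
  using subgroup.m_closed[OF submodule.axioms(1)] by force

lemma submodule_smult: "submodule U R M \<Longrightarrow> a \<in> carrier R \<Longrightarrow> x \<in> U \<Longrightarrow> a \<odot>\<^bsub>M\<^esub> x \<in> U"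
  by (rule submodule.smult_closed)

lemma submodule_zero_set: "submodule {\<zero>\<^bsub>M\<^esub>} R M"
  by (rule submoduleI) (auto simp: smult_r_null)

end

section \<open>Homomorphisms: preimages, images and kernels\<close>

locale lmodule_homomorphism = M: lmodule R M + N: lmodule R N
  for R :: "('a, 'r) ring_scheme" (structure) and M :: "('a, 'b, 'm) module_scheme"
    and N :: "('a, 'c, 'n) module_scheme" +
  fixes h :: "'b \<Rightarrow> 'c"
  assumes hom: "h \<in> lmodule_hom R M N"
begin

lemma closed: "x \<in> carrier M \<Longrightarrow> h x \<in> carrier N"
  using hom by (auto simp: lmodule_hom_def)

lemma add: "x \<in> carrier M \<Longrightarrow> y \<in> carrier M \<Longrightarrow> h (x \<oplus>\<^bsub>M\<^esub> y) = h x \<oplus>\<^bsub>N\<^esub> h y"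
  using hom by (auto simp: lmodule_hom_def)

lemma smult: "a \<in> carrier R \<Longrightarrow> x \<in> carrier M \<Longrightarrow> h (a \<odot>\<^bsub>M\<^esub> x) = a \<odot>\<^bsub>N\<^esub> h x"
  using hom by (auto simp: lmodule_hom_def)

lemma zero: "h \<zero>\<^bsub>M\<^esub> = \<zero>\<^bsub>N\<^esub>"
  using smult[of \<zero> "\<zero>\<^bsub>M\<^esub>"] closed[of "\<zero>\<^bsub>M\<^esub>"]
  by (simp add: M.smult_l_null N.smult_l_null)

lemma submodule_preimage:
  assumes "submodule U R N"
  shows "submodule {x \<in> carrier M. h x \<in> U} R M"
  using N.submodule_zero[OF assms] N.submodule_add[OF assms] N.submodule_smult[OF assms]
  by (intro M.submoduleI) (auto simp: zero add smult M.smult_closed)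

lemma submodule_image:
  assumes "submodule U R M"
  shows "submodule (h ` U) R N"
proof (rule N.submoduleI)
  note U = M.submodule_subset[OF assms]
  show "h ` U \<subseteq> carrier N"
    using U closed by auto
  show "\<zero>\<^bsub>N\<^esub> \<in> h ` U"
    using M.submodule_zero[OF assms] zero by force
  show "x \<oplus>\<^bsub>N\<^esub> y \<in> h ` U" if "x \<in> h ` U" "y \<in> h ` U" for x y
    using that U M.submodule_add[OF assms] by (force simp: add[symmetric] subset_iff)
  show "a \<odot>\<^bsub>N\<^esub> x \<in> h ` U" if "a \<in> carrier R" "x \<in> h ` U" for a x
    using that U M.submodule_smult[OF assms] by (force simp: smult[symmetric] subset_iff)
qed

text \<open>Membership in a singleton presents the kernel as the preimage of the zero submodule, the
  shape that \<open>submodule_preimage\<close> expects.\<close>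

lemma a_kernel_eq: "a_kernel M N h = {x \<in> carrier M. h x \<in> {\<zero>\<^bsub>N\<^esub>}}"
  by (simp add: a_kernel_def kernel_def)

lemma submodule_a_kernel: "submodule (a_kernel M N h) R M"
  unfolding a_kernel_eq by (rule submodule_preimage[OF N.submodule_zero_set])

text \<open>Each \<open>x\<close> has the same image as some \<open>u\<close> in \<open>U\<close>,
  and the two differ by an element of the kernel.\<close>

lemma add_kernel_eq_carrier:
  assumes "submodule U R M" "h ` U = h ` carrier M"
  shows "U <+>\<^bsub>M\<^esub> a_kernel M N h = carrier M"
proof
  note U = M.submodule_subset[OF assms(1)]
  show "U <+>\<^bsub>M\<^esub> a_kernel M N h \<subseteq> carrier M"
    using U by (auto simp: set_add_def' a_kernel_eq)
  show "carrier M \<subseteq> U <+>\<^bsub>M\<^esub> a_kernel M N h"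
  proof
    fix x assume x: "x \<in> carrier M"
    then obtain u where u: "u \<in> U" "h u = h x"
      using assms(2) by (metis imageE imageI)
    have uM: "u \<in> carrier M"
      using U u by blast
    \<comment> \<open>Comparison with \<open>h\<close> of a sum that is zero uses only additivity,
      so the image of a negative need not be computed.\<close>
    have "h (\<ominus>\<^bsub>M\<^esub> u \<oplus>\<^bsub>M\<^esub> x) = h (\<ominus>\<^bsub>M\<^esub> u \<oplus>\<^bsub>M\<^esub> u)"
      using x uM u(2) by (simp add: add del: M.M.l_neg)
    then have "\<ominus>\<^bsub>M\<^esub> u \<oplus>\<^bsub>M\<^esub> x \<in> a_kernel M N h"
      using x uM by (simp add: a_kernel_eq zero M.M.l_neg)
    moreover have "u \<oplus>\<^bsub>M\<^esub> (\<ominus>\<^bsub>M\<^esub> u \<oplus>\<^bsub>M\<^esub> x) = x"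
      using x uM by (simp add: M.M.r_neg2)
    ultimately show "x \<in> U <+>\<^bsub>M\<^esub> a_kernel M N h"
      using u(1) unfolding set_add_def' by force
  qed
qed

end

section \<open>Radical and length of projective covers\<close>

lemma lmodule_length_ge:
  assumes "\<And>i. i \<le> l \<Longrightarrow> submodule (U i) R M" "\<And>i. i < l \<Longrightarrow> U i \<subset> U (Suc i)"
  shows "enat l \<le> lmodule_length R M"
  unfolding lmodule_length_def using assms by (intro Sup_upper) blast

lemma proper_submodule_le_rad:
  assumes cover: "projective_cover R P S" and "simple_lmodule R S"
    and U: "submodule U R P" "U \<noteq> carrier P"
  shows "U \<subseteq> carrier (lmodule_rad R P)"
proof -
  obtain p where p: "p \<in> lmodule_hom R P S" "p ` carrier P = carrier S"
    and "\<forall>V. submodule V R P \<and> V <+>\<^bsub>P\<^esub> a_kernel P S p = carrier P \<longrightarrow> V = carrier P"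
    using cover unfolding projective_cover_def by (elim conjE bexE)
  then have small: "\<And>V. submodule V R P \<Longrightarrow> V <+>\<^bsub>P\<^esub> a_kernel P S p = carrier P
      \<Longrightarrow> V = carrier P"
    by simp
  have S: "carrier S \<noteq> {\<zero>\<^bsub>S\<^esub>}" "\<And>V. submodule V R S \<Longrightarrow> V = {\<zero>\<^bsub>S\<^esub>} \<or> V = carrier S"
    using assms(2) by (auto simp: simple_lmodule_def)
  have "lmodule R P" "lmodule R S"
    using cover assms(2)
    by (auto simp: projective_cover_def projective_lmodule_def finite_length_lmodule_def
        simple_lmodule_def)
  then interpret lmodule_homomorphism R P S p
    using p(1) by (simp add: lmodule_homomorphism_def lmodule_homomorphism_axioms_def)
  let ?K = "a_kernel P S p"
  have proper_le: "V \<subseteq> ?K" if V: "submodule V R P" "V \<noteq> carrier P" for V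
  proof -
    have "p ` V \<noteq> carrier S"
      using small[OF V(1)] add_kernel_eq_carrier[OF V(1)] V(2) p(2) by auto
    then have "p ` V = {\<zero>\<^bsub>S\<^esub>}"
      using S(2)[OF submodule_image[OF V(1)]] by blast
    then show ?thesis
      using M.submodule_subset[OF V(1)] by (auto simp: a_kernel_eq)
  qed
  \<comment> \<open>Properness of \<open>K\<close> matters because a maximal submodule contained in
    \<open>K\<close> must then equal \<open>K\<close>.\<close>
  have "?K \<noteq> carrier P"
  proof
    assume "?K = carrier P"
    then have "carrier S \<subseteq> {\<zero>\<^bsub>S\<^esub>}"
      unfolding p(2)[symmetric] a_kernel_eq by blast
    then show False
      using S(1) N.M.zero_closed by blast
  qed
  then have "W = ?K" if "maximal_submodule W R P" for W
    using that proper_le[of W] submodule_a_kernel unfolding maximal_submodule_def by metis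
  then show ?thesis
    using proper_le[OF U] M.submodule_subset[OF U(1)] by (auto simp: lmodule_rad_def)
qed

text \<open>All terms of a strict chain but the last are proper, hence lie in the radical, which is
  the image of \<open>Q\<close>. Preimages in \<open>Q\<close> therefore stay strictly
  increasing.\<close>

lemma lmodule_length_le_of_factor_rad:
  assumes cover: "projective_cover R P S" and S: "simple_lmodule R S"
    and Q: "lmodule R Q" and factor: "factor_module R (lmodule_rad R P) Q"
  shows "lmodule_length R P \<le> lmodule_length R Q + 1"
  unfolding lmodule_length_def[of R P]
proof (rule Sup_least, clarify)
  fix l and U :: "nat \<Rightarrow> _"
  assume sub: "\<forall>i\<le>l. submodule (U i) R P" and strict: "\<forall>i<l. U i \<subset> U (Suc i)"
  show "enat l \<le> lmodule_length R Q + 1"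
  proof (cases l)
    case 0
    then show ?thesis by (simp add: enat_0)
  next
    case (Suc l')
    obtain h where h: "h \<in> lmodule_hom R Q (lmodule_rad R P)"
      and onto: "h ` carrier Q = carrier (lmodule_rad R P)"
      using factor by (auto simp: factor_module_def)
    \<comment> \<open>The radical has the operations of \<open>P\<close> on a smaller carrier, so
      \<open>h\<close> can be treated as a homomorphism into \<open>P\<close>.\<close>
    have "h \<in> lmodule_hom R Q P"
      using h by (auto simp: lmodule_hom_def lmodule_rad_def)
    moreover have P: "lmodule R P"
      using cover
      by (auto simp: projective_cover_def projective_lmodule_def finite_length_lmodule_def)
    ultimately interpret lmodule_homomorphism R Q P h
      using Q by (simp add: lmodule_homomorphism_def lmodule_homomorphism_axioms_def)
    \<comment> \<open>The bound \<open>l'\<close> excludes only the top term \<open>U l\<close>,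
      which may be all of \<open>P\<close>.\<close>
    have rad: "U i \<subseteq> h ` carrier Q" if "i \<le> l'" for i
    proof -
      have "U i \<subset> U (Suc i)" "submodule (U i) R P" "submodule (U (Suc i)) R P"
        using sub strict that Suc by simp_all
      then show ?thesis
        unfolding onto using N.submodule_subset
        by (intro proper_submodule_le_rad[OF cover S]) blast+
    qed
    let ?V = "\<lambda>i. {x \<in> carrier Q. h x \<in> U i}"
    have "enat l' \<le> lmodule_length R Q"
    proof (rule lmodule_length_ge)
      show "submodule (?V i) R Q" if "i \<le> l'" for i
        using sub that Suc by (intro submodule_preimage) simp
      show "?V i \<subset> ?V (Suc i)" if "i < l'" for i
      proof -
        have lt: "U i \<subset> U (Suc i)" using strict that Suc by simp
        then obtain y where y: "y \<in> U (Suc i)" "y \<notin> U i" by blast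
        \<comment> \<open>Here \<open>Suc i \<le> l'\<close>, so the element \<open>y\<close>
          witnessing strictness has a preimage under \<open>h\<close>.\<close>
        have "U (Suc i) \<subseteq> h ` carrier Q"
          using that by (intro rad) simp
        then obtain x where "x \<in> carrier Q" "h x = y"
          using y(1) by auto
        with y lt show ?thesis by blast
      qed
    qed
    then have "enat l' + 1 \<le> lmodule_length R Q + 1"
      by (rule add_right_mono)
    then show ?thesis
      by (simp add: Suc one_enat_def)
  qed
qed

lemma admissible_sequence_le_Suc:
  assumes "admissible_sequence A n S P c" and i: "i \<in> {1..n}"
  shows "c i \<le> c (cyclic_succ n i) + 1"
proof -
  have j: "cyclic_succ n i \<in> {1..n}"
    using i by (auto simp: cyclic_succ_def)
  have "lmodule A (P (cyclic_succ n i))"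
    using assms(1) j
    by (auto simp: admissible_sequence_def projective_cover_def projective_lmodule_def
        finite_length_lmodule_def)
  then have "lmodule_length A (P i) \<le> lmodule_length A (P (cyclic_succ n i)) + 1"
    using assms by (intro lmodule_length_le_of_factor_rad[of A "P i" "S i"])
      (auto simp: admissible_sequence_def)
  then show ?thesis
    using assms(1) i j by (simp add: admissible_sequence_def one_enat_def)
qed

theorem proposition1p1:
  fixes k :: "('k, 'l) ring_scheme"
    and A :: "('k, 'a, 'm) module_scheme"
    and n :: nat
    and S :: "nat \<Rightarrow> ('a, 's) module"
    and P :: "nat \<Rightarrow> ('a, 'p) module"
    and c :: "nat \<Rightarrow> nat"
    and C C' :: "nat list"
  assumes "artin_algebra k A"
    and "connected_ring A"
    and "nakayama_ring A"
    and "admissible_sequence A n S P c"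
    and "resolution_cycle n c C"
    and "resolution_cycle n c C'"
  shows "length C = length C' \<and> cycle_weight n c C = cycle_weight n c C'"
proof (rule resolution_cycles_agree)
  \<comment> \<open>A cycle has at least one vertex, so \<open>{1..n}\<close> is nonempty.\<close>
  show "n > 0"
    using assms(5) by (cases n) (auto simp: resolution_cycle_def)
  show "c i \<le> c (cyclic_succ n i) + 1" if "i \<in> {1..n}" for i
    using assms(4) that by (rule admissible_sequence_le_Suc)
qed (fact assms(5,6))+

end
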